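(* The set $\partial\mathcal{W}_{\mathrm{un}}\setminus\mathcal{A}_{\mathrm{un}}$ is locally spherical; that is, the boundary of the unbounded worm domain is locally spherical near all of its strongly pseudoconvex points. In particular, the mapping $$(z,w)\mapsto\left(i-iz^{i},\ i-2iz^{i}+\frac{2iz^{2i}}{w}\right)$$ maps $\partial\mathcal{W}_{\mathrm{un}}\setminus\mathcal{A}_{\mathrm{un}}$, locally near the point $(1,2)$, into the Heisenberg hypersurface $\mathbb{H}$, sending $(1,2)$ to $(0,0)$.
   Context: The unbounded worm domain is $\mathcal{W}_{\mathrm{un}}=\{(z,w)\in\mathbb{C}^2:\ |w-e^{i\log|z|^2}|^2<1,\ z\neq0\}$ and $\mathcal{A}_{\mathrm{un}}=\{(z,0)\in\partial\mathcal{W}_{\mathrm{un}}\}$; thus $\partial\mathcal{W}_{\mathrm{un}}\setminus\mathcal{A}_{\mathrm{un}}=\{(z,w):\ z\ne0,\ w\neq0,\ |w-e^{i\log|z|^2}|^2=1\}$, which is the set of strongly pseudoconvex boundary points. For $a\in\mathbb{R}$, $z^{ia}=e^{ia\log z}$, with the branch of $\log$ near $z=1$ satisfying $\log 1=0$. The Heisenberg hypersurface is $\mathbb{H}=\{(Z,W)\in\mathbb{C}^2:\operatorname{Im}W=|Z|^2\}$. A real hypersurface $M\subset\mathbb{C}^2$ is locally spherical if for every $p\in M$ there are an open neighborhood $U$ of $p$ in $\mathbb{C}^2$ and a biholomorphic map $\Phi$ from $U$ onto an open subset of $\mathbb{C}^2$ with $\Phi(M\cap U)\subset\mathbb{H}$.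 *)

theory Defs
  imports "HOL-Analysis.Analysis"
begin

section \<open>Holomorphic maps of \<open>\<complex>\<^sup>2\<close>\<close>

definition cscale :: "complex \<Rightarrow> complex \<times> complex \<Rightarrow> complex \<times> complex" where
  "cscale c v = (c * fst v, c * snd v)"

text \<open>Holomorphic means: Frechet differentiable with complex linear derivative.\<close>

definition holomorphic_map_on ::
    "(complex \<times> complex \<Rightarrow> complex \<times> complex) \<Rightarrow> (complex \<times> complex) set \<Rightarrow> bool" where
  "holomorphic_map_on f U \<longleftrightarrow>
     (\<forall>p\<in>U. \<exists>f'. (f has_derivative f') (at p) \<and> (\<forall>c v. f' (cscale c v) = cscale c (f' v)))"

definition biholomorphic_onto_image ::
    "(complex \<times> complex \<Rightarrow> complex \<times> complex) \<Rightarrow> (complex \<times> complex) set \<Rightarrow> bool" where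
  "biholomorphic_onto_image f U \<longleftrightarrow>
     open U \<and> open (f ` U) \<and> inj_on f U \<and>
     holomorphic_map_on f U \<and> holomorphic_map_on (inv_into U f) (f ` U)"

section \<open>Real hypersurfaces and strong pseudoconvexity\<close>

text \<open>\<open>Ck_on k f U\<close> is only meant for open \<open>U\<close>.\<close>

fun Ck_on :: "nat \<Rightarrow> (complex \<times> complex \<Rightarrow> real) \<Rightarrow> (complex \<times> complex) set \<Rightarrow> bool" where
  "Ck_on 0 f U \<longleftrightarrow> continuous_on U f"
| "Ck_on (Suc k) f U \<longleftrightarrow>
     (\<forall>q\<in>U. f differentiable (at q)) \<and>
     (\<forall>v. Ck_on k (\<lambda>q. frechet_derivative f (at q) v) U)"

definition real_hypersurface :: "(complex \<times> complex) set \<Rightarrow> bool" where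
  "real_hypersurface M \<longleftrightarrow>
     (\<forall>p\<in>M. \<exists>U \<rho>. open U \<and> p \<in> U \<and> (\<forall>k. Ck_on k \<rho> U) \<and>
        M \<inter> U = {q \<in> U. \<rho> q = 0} \<and>
        (\<forall>q \<in> M \<inter> U. \<exists>v. frechet_derivative \<rho> (at q) v \<noteq> 0))"

definition second_derivative ::
    "(complex \<times> complex \<Rightarrow> real) \<Rightarrow> complex \<times> complex \<Rightarrow>
     complex \<times> complex \<Rightarrow> complex \<times> complex \<Rightarrow> real" where
  "second_derivative \<rho> p u v =
     frechet_derivative (\<lambda>q. frechet_derivative \<rho> (at q) u) (at p) v"

text \<open>
  Writing \<open>D\<^sup>2\<rho>\<close> for the real Hessian, the Levi form
  \<open>\<Sum>j k. (\<partial>\<^sup>2\<rho> / \<partial>z\<^sub>j \<partial>cnj z\<^sub>k) * v\<^sub>j * cnj v\<^sub>k\<close>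
  is \<open>(D\<^sup>2\<rho> v v + D\<^sup>2\<rho> (\<i>v) (\<i>v)) / 4\<close>, which is the expression used here.
\<close>

definition levi_form ::
    "(complex \<times> complex \<Rightarrow> real) \<Rightarrow> complex \<times> complex \<Rightarrow> complex \<times> complex \<Rightarrow> real" where
  "levi_form \<rho> p v =
     (second_derivative \<rho> p v v + second_derivative \<rho> p (cscale \<i> v) (cscale \<i> v)) / 4"

text \<open>
  \<open>\<Sum>j. (\<partial>\<rho> / \<partial>z\<^sub>j) * v\<^sub>j = 0\<close> holds iff the real differential of \<open>\<rho>\<close> vanishes at
  both \<open>v\<close> and \<open>\<i>v\<close>.
\<close>

definition complex_tangent ::
    "(complex \<times> complex \<Rightarrow> real) \<Rightarrow> complex \<times> complex \<Rightarrow> complex \<times> complex \<Rightarrow> bool" where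
  "complex_tangent \<rho> p v \<longleftrightarrow>
     frechet_derivative \<rho> (at p) v = 0 \<and> frechet_derivative \<rho> (at p) (cscale \<i> v) = 0"

definition strongly_pseudoconvex_at ::
    "(complex \<times> complex) set \<Rightarrow> complex \<times> complex \<Rightarrow> bool" where
  "strongly_pseudoconvex_at D p \<longleftrightarrow>
     (\<exists>U \<rho>. open U \<and> p \<in> U \<and> Ck_on 2 \<rho> U \<and>
        D \<inter> U = {q \<in> U. \<rho> q < 0} \<and> \<rho> p = 0 \<and>
        (\<exists>v. frechet_derivative \<rho> (at p) v \<noteq> 0) \<and>
        (\<forall>v. v \<noteq> 0 \<and> complex_tangent \<rho> p v \<longrightarrow> levi_form \<rho> p v > 0))"

section \<open>Local sphericity\<close>

definition heisenberg :: "(complex \<times> complex) set" where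
  "heisenberg = {(Z, W). Im W = (cmod Z)\<^sup>2}"

definition locally_spherical_at :: "(complex \<times> complex) set \<Rightarrow> complex \<times> complex \<Rightarrow> bool" where
  "locally_spherical_at M p \<longleftrightarrow>
     (\<exists>U \<Phi>. open U \<and> p \<in> U \<and> biholomorphic_onto_image \<Phi> U \<and> \<Phi> ` (M \<inter> U) \<subseteq> heisenberg)"

definition locally_spherical :: "(complex \<times> complex) set \<Rightarrow> bool" where
  "locally_spherical M \<longleftrightarrow> real_hypersurface M \<and> (\<forall>p\<in>M. locally_spherical_at M p)"

section \<open>The unbounded worm domain\<close>

definition worm :: "(complex \<times> complex) set" where
  "worm = {(z, w). (cmod (w - exp (\<i> * of_real (ln ((cmod z)\<^sup>2)))))\<^sup>2 < 1 \<and> z \<noteq> 0}"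

text \<open>
  The boundary is taken in \<open>(\<complex> - {0}) \<times> \<complex>\<close>: the frontier in \<open>\<complex>\<^sup>2\<close> also contains
  \<open>{0} \<times> cball 0 2\<close>, as \<open>exp (\<i> * ln \<bar>z\<bar>\<^sup>2)\<close> keeps winding around the unit circle
  when \<open>z\<close> tends to \<open>0\<close>.
\<close>

definition worm_boundary :: "(complex \<times> complex) set" where
  "worm_boundary = frontier worm \<inter> {(z, w). z \<noteq> 0}"

definition worm_annulus :: "(complex \<times> complex) set" where
  "worm_annulus = {(z, w). w = 0 \<and> (z, 0) \<in> worm_boundary}"

lemma worm_boundary_eq:
  "worm_boundary = {(z, w). z \<noteq> 0 \<and> (cmod (w - exp (\<i> * of_real (ln ((cmod z)\<^sup>2)))))\<^sup>2 = 1}"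
proof -
  define S :: "(complex \<times> complex) set" where "S = {p. fst p \<noteq> 0}"
  define c :: "complex \<Rightarrow> complex" where "c = (\<lambda>z. exp (\<i> * of_real (ln ((cmod z)\<^sup>2))))"
  define f :: "complex \<times> complex \<Rightarrow> real" where
    "f = (\<lambda>p. (cmod (snd p - c (fst p)))\<^sup>2)"
  have oS: "open S"
  proof -
    have "S = fst -` (- {0})" by (auto simp: S_def)
    then show ?thesis using open_vimage_fst[of "- {0::complex}"] by (simp add: open_Compl)
  qed
  have cf: "continuous_on S f"
    unfolding f_def S_def c_def by (intro continuous_intros) auto
  have W: "worm = {p \<in> S. f p < 1}"
    by (auto simp: worm_def S_def f_def c_def)
  have pre: "open {p \<in> S. f p \<in> T}" if "open T" for T
  proof -
    have "{p \<in> S. f p \<in> T} = f -` T \<inter> S" by auto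
    then show ?thesis using continuous_on_open_vimage[OF oS] cf that by metis
  qed
  have ow: "open worm"
    using pre[of "{..<1}"] by (simp add: W)
  have "p \<in> frontier worm \<longleftrightarrow> f p = 1" if p: "p \<in> S" for p
  proof
    assume a: "p \<in> frontier worm"
    then have "p \<notin> worm" using ow by (simp add: frontier_def interior_open)
    then have "f p \<ge> 1" using p by (auto simp: W)
    moreover have "\<not> f p > 1"
    proof
      assume "f p > 1"
      moreover have "open {p \<in> S. f p > 1}" using pre[of "{1<..}"] by simp
      moreover have "{p \<in> S. f p > 1} \<inter> closure worm = {}"
        using calculation by (subst open_Int_closure_eq_empty) (auto simp: W)
      ultimately show False using a p by (auto simp: frontier_def)
    qed
    ultimately show "f p = 1" by simp
  next
    assume a: "f p = 1"
    obtain z w where zw: "p = (z, w)" by (cases p)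
    define g where "g = (\<lambda>t::real. (z, c z + of_real (1 - t) * (w - c z)))"
    have "g \<midarrow>0\<rightarrow> g 0"
      unfolding g_def by (intro tendsto_intros)
    then have "(g \<longlongrightarrow> g 0) (at_right 0)"
      by (rule tendsto_within_subset) auto
    moreover have "g 0 = p" by (simp add: g_def zw)
    moreover have "eventually (\<lambda>t. g t \<in> closure worm) (at_right 0)"
    proof -
      have n: "cmod (w - c z) = 1"
        using a by (simp add: f_def zw power2_eq_1_iff)
          (metis abs_norm_cancel abs_minus_cancel abs_one)
      have "g t \<in> worm" if "0 < t" "t < 1" for t
      proof -
        have "f (g t) = (1 - t)\<^sup>2"
          using n by (simp only: f_def g_def fst_conv snd_conv add_diff_cancel_left'
            norm_mult norm_of_real mult_1_right power2_abs)
        also have "\<dots> < 1" using that by (simp add: power_less_one_iff)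
        finally show ?thesis using p by (simp add: W S_def g_def zw)
      qed
      then show ?thesis
        unfolding eventually_at_right_field
        using closure_subset by (intro exI[of _ 1]) auto
    qed
    ultimately have "p \<in> closure worm"
      using Lim_in_closed_set[of "closure worm" g "at_right 0" p] by simp
    moreover have "p \<notin> worm" using a by (simp add: W)
    ultimately show "p \<in> frontier worm" using ow by (simp add: frontier_def interior_open)
  qed
  then show ?thesis
    unfolding worm_boundary_def by (auto simp: S_def f_def c_def)
qed

lemma worm_boundary_minus_annulus_eq:
  "worm_boundary - worm_annulus =
     {(z, w). z \<noteq> 0 \<and> w \<noteq> 0 \<and> (cmod (w - exp (\<i> * of_real (ln ((cmod z)\<^sup>2)))))\<^sup>2 = 1}"
  by (auto simp: worm_annulus_def worm_boundary_eq)

end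

theory Submission
  imports Defs
begin

text \<open>
  The idea is that a branch \<open>u\<close> of \<open>z\<^sup>i\<close> turns the rotating centre of the worm into a ratio of a
  holomorphic and an antiholomorphic function: if \<open>exp s = z\<close> and \<open>u = exp (\<i> s)\<close>, then
  \<open>exp (\<i> * ln \<bar>z\<bar>\<^sup>2) = u / cnj u\<close> (\<open>worm_centre_eq_ratio\<close>).  Expanding
  \<open>\<bar>w - u / cnj u\<bar>\<^sup>2 = 1\<close> and dividing by \<open>\<bar>w\<bar>\<^sup>2\<close> gives \<open>\<bar>u\<bar>\<^sup>2 = 2 Re (u\<^sup>2 / w)\<close>.  In the
  coordinates \<open>(u, 2 u\<^sup>2 / w)\<close> the boundary away from \<open>w = 0\<close> thus lies in the Heisenberg
  hypersurface, up to a factor \<open>\<i>\<close> in the second coordinate.  A further affine automorphism of the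
  Heisenberg hypersurface moves the point with \<open>u = 1\<close> and \<open>w = 2\<close> to the origin
  (\<open>worm_map_in_heisenberg\<close>).

  The map is biholomorphic because it has an explicit holomorphic inverse: \<open>u\<close> is an affine function
  of the first coordinate, and \<open>u\<close> determines \<open>z = u\<^sup>-\<^sup>i\<close> once the branches are controlled.
  Multiplication by \<open>\<i>\<close> preserves the square \<open>\<bar>Re s\<bar> < pi, \<bar>Im s\<bar> < pi\<close>, so on the
  exponential of that square the principal powers with exponents \<open>\<i>\<close> and \<open>-\<i>\<close> are inverse to each
  other.  Centring this region at the first coordinate of the given boundary point makes the
  construction work near every point with \<open>w \<noteq> 0\<close> (\<open>biholomorphic_worm_map\<close>).

  The points with \<open>w = 0\<close> are not strongly pseudoconvex.  There the boundary contains the complex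
  curve \<open>w = 0\<close>, on which every defining function vanishes.  The direction of the curve is therefore
  a complex tangent direction in which the Levi form is zero
  (\<open>worm_annulus_not_strongly_pseudoconvex\<close>).
\<close>

section \<open>Holomorphic functions of two variables\<close>

text \<open>
  Complex linear functionals on \<open>\<complex>\<^sup>2\<close> are written with coefficients, since in this form the closure
  properties below are computations with the two partial derivatives.
\<close>

definition holomorphic_fun_on :: "(complex \<times> complex \<Rightarrow> complex) \<Rightarrow> (complex \<times> complex) set \<Rightarrow> bool" where
  "holomorphic_fun_on f U \<longleftrightarrow>
     (\<forall>p\<in>U. \<exists>a b. (f has_derivative (\<lambda>v. a * fst v + b * snd v)) (at p))"

lemma holomorphic_fun_onI:
  assumes "\<And>p. p \<in> U \<Longrightarrow> (f has_derivative (\<lambda>v. a p * fst v + b p * snd v)) (at p)"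
  shows "holomorphic_fun_on f U"
  using assms unfolding holomorphic_fun_on_def by blast

lemma holomorphic_fun_onD:
  assumes "holomorphic_fun_on f U"
  shows "\<exists>a b. \<forall>p\<in>U. (f has_derivative (\<lambda>v. a p * fst v + b p * snd v)) (at p)"
  using assms unfolding holomorphic_fun_on_def by metis

lemma holomorphic_fun_on_const: "holomorphic_fun_on (\<lambda>p. c) U"
  by (rule holomorphic_fun_onI[of _ _ "\<lambda>_. 0" "\<lambda>_. 0"]) (auto intro!: derivative_eq_intros)

lemma holomorphic_fun_on_fst: "holomorphic_fun_on fst U"
  by (rule holomorphic_fun_onI[of _ _ "\<lambda>_. 1" "\<lambda>_. 0"]) (auto intro!: derivative_eq_intros)

lemma holomorphic_fun_on_snd: "holomorphic_fun_on snd U"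
  by (rule holomorphic_fun_onI[of _ _ "\<lambda>_. 0" "\<lambda>_. 1"]) (auto intro!: derivative_eq_intros)

lemma holomorphic_fun_on_add:
  assumes f: "holomorphic_fun_on f U" and g: "holomorphic_fun_on g U"
  shows "holomorphic_fun_on (\<lambda>p. f p + g p) U"
proof -
  obtain a b where f': "\<And>p. p \<in> U \<Longrightarrow> (f has_derivative (\<lambda>v. a p * fst v + b p * snd v)) (at p)"
    using holomorphic_fun_onD[OF f] by blast
  obtain c d where g': "\<And>p. p \<in> U \<Longrightarrow> (g has_derivative (\<lambda>v. c p * fst v + d p * snd v)) (at p)"
    using holomorphic_fun_onD[OF g] by blast
  show ?thesis
    by (rule holomorphic_fun_onI[of _ _ "\<lambda>p. a p + c p" "\<lambda>p. b p + d p"])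
      (rule derivative_eq_intros f' g' | assumption | simp add: algebra_simps)+
qed

lemma holomorphic_fun_on_mult:
  assumes f: "holomorphic_fun_on f U" and g: "holomorphic_fun_on g U"
  shows "holomorphic_fun_on (\<lambda>p. f p * g p) U"
proof -
  obtain a b where f': "\<And>p. p \<in> U \<Longrightarrow> (f has_derivative (\<lambda>v. a p * fst v + b p * snd v)) (at p)"
    using holomorphic_fun_onD[OF f] by blast
  obtain c d where g': "\<And>p. p \<in> U \<Longrightarrow> (g has_derivative (\<lambda>v. c p * fst v + d p * snd v)) (at p)"
    using holomorphic_fun_onD[OF g] by blast
  show ?thesis
    by (rule holomorphic_fun_onI[of _ _ "\<lambda>p. a p * g p + f p * c p" "\<lambda>p. b p * g p + f p * d p"])
      (rule derivative_eq_intros f' g' | assumption | simp add: algebra_simps)+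
qed

lemma holomorphic_fun_on_compose:
  assumes f: "holomorphic_fun_on f U"
    and h: "\<And>p. p \<in> U \<Longrightarrow> h field_differentiable (at (f p))"
  shows "holomorphic_fun_on (\<lambda>p. h (f p)) U"
proof -
  obtain a b where f': "\<And>p. p \<in> U \<Longrightarrow> (f has_derivative (\<lambda>v. a p * fst v + b p * snd v)) (at p)"
    using holomorphic_fun_onD[OF f] by blast
  obtain h' where h': "\<And>p. p \<in> U \<Longrightarrow> (h has_field_derivative h' p) (at (f p))"
    using h unfolding field_differentiable_def by metis
  show ?thesis
  proof (rule holomorphic_fun_onI[of _ _ "\<lambda>p. h' p * a p" "\<lambda>p. h' p * b p"])
    fix p assume p: "p \<in> U"
    show "((\<lambda>p. h (f p)) has_derivative (\<lambda>v. h' p * a p * fst v + h' p * b p * snd v)) (at p)"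
      using has_derivative_compose[OF f'[OF p] h'[OF p, unfolded has_field_derivative_def]]
      by (simp add: algebra_simps)
  qed
qed

lemma holomorphic_fun_on_diff:
  assumes f: "holomorphic_fun_on f U" and g: "holomorphic_fun_on g U"
  shows "holomorphic_fun_on (\<lambda>p. f p - g p) U"
  using holomorphic_fun_on_add[OF f holomorphic_fun_on_mult[OF holomorphic_fun_on_const[of "-1"] g]]
  by simp

lemma holomorphic_fun_on_divide:
  assumes f: "holomorphic_fun_on f U" and g: "holomorphic_fun_on g U" and "\<And>p. p \<in> U \<Longrightarrow> g p \<noteq> 0"
  shows "holomorphic_fun_on (\<lambda>p. f p / g p) U"
  unfolding divide_inverse
  by (intro holomorphic_fun_on_mult f holomorphic_fun_on_compose[OF g] derivative_intros
      field_differentiable_inverse assms) (use assms in auto)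

lemma holomorphic_fun_on_powr:
  assumes f: "holomorphic_fun_on f U" and "\<And>p. p \<in> U \<Longrightarrow> f p \<notin> \<real>\<^sub>\<le>\<^sub>0"
  shows "holomorphic_fun_on (\<lambda>p. f p powr c) U"
  using assms(2)
  by (intro holomorphic_fun_on_compose[OF f, of "\<lambda>z. z powr c"])
    (auto simp: field_differentiable_def intro: has_field_derivative_powr)

lemmas holomorphic_fun_intros =
  holomorphic_fun_on_const holomorphic_fun_on_fst holomorphic_fun_on_snd holomorphic_fun_on_add
  holomorphic_fun_on_mult holomorphic_fun_on_diff holomorphic_fun_on_divide holomorphic_fun_on_powr

lemma holomorphic_map_on_Pair:
  assumes f: "holomorphic_fun_on f U" and g: "holomorphic_fun_on g U"
  shows "holomorphic_map_on (\<lambda>p. (f p, g p)) U"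
proof -
  obtain a b where f': "\<And>p. p \<in> U \<Longrightarrow> (f has_derivative (\<lambda>v. a p * fst v + b p * snd v)) (at p)"
    using holomorphic_fun_onD[OF f] by blast
  obtain c d where g': "\<And>p. p \<in> U \<Longrightarrow> (g has_derivative (\<lambda>v. c p * fst v + d p * snd v)) (at p)"
    using holomorphic_fun_onD[OF g] by blast
  show ?thesis
    unfolding holomorphic_map_on_def
    by (intro ballI exI conjI, rule has_derivative_Pair[OF f' g'])
      (auto simp: cscale_def algebra_simps)
qed

lemma holomorphic_map_on_cong:
  assumes "holomorphic_map_on f U" "open U" "\<And>p. p \<in> U \<Longrightarrow> f p = g p"
  shows "holomorphic_map_on g U"
  using assms unfolding holomorphic_map_on_def
  by (metis has_derivative_transform_within_open)

lemma biholomorphic_onto_imageI: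
  assumes oU: "open U" and oV: "open V"
    and f: "holomorphic_map_on f U" and g: "holomorphic_map_on g V"
    and fV: "\<And>p. p \<in> U \<Longrightarrow> f p \<in> V" and gU: "\<And>q. q \<in> V \<Longrightarrow> g q \<in> U"
    and gf: "\<And>p. p \<in> U \<Longrightarrow> g (f p) = p" and fg: "\<And>q. q \<in> V \<Longrightarrow> f (g q) = q"
  shows "biholomorphic_onto_image f U"
proof -
  have inj: "inj_on f U"
    using gf by (metis inj_onI)
  have im: "f ` U = V"
    using fV gU fg by force
  have "g q = inv_into U f q" if "q \<in> V" for q
    using inv_into_f_f[OF inj gU[OF that]] fg[OF that] by simp
  then have "holomorphic_map_on (inv_into U f) V"
    using holomorphic_map_on_cong[OF g oV] by simp
  then show ?thesis
    unfolding biholomorphic_onto_image_def im using oU oV inj f by simp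
qed

section \<open>The principal powers with exponents \<open>\<i>\<close> and \<open>-\<i>\<close>\<close>

text \<open>
  This is the image under \<open>exp\<close> of the open square with vertices \<open>\<plusminus> pi \<plusminus> \<i> pi\<close>.  The bound on the
  modulus is the one that makes multiplication of the logarithm by \<open>\<i>\<close> a symmetry.
\<close>

definition exp_square :: "complex set" where
  "exp_square = {\<zeta>. \<zeta> \<notin> \<real>\<^sub>\<le>\<^sub>0 \<and> exp (-pi) < cmod \<zeta> \<and> cmod \<zeta> < exp pi}"

lemma exp_square_iff:
  "\<zeta> \<in> exp_square \<longleftrightarrow> \<zeta> \<noteq> 0 \<and> \<bar>Re (Ln \<zeta>)\<bar> < pi \<and> \<bar>Im (Ln \<zeta>)\<bar> < pi"
proof (cases "\<zeta> = 0")
  case False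
  have "exp (-pi) < cmod \<zeta> \<longleftrightarrow> -pi < ln (cmod \<zeta>)" "cmod \<zeta> < exp pi \<longleftrightarrow> ln (cmod \<zeta>) < pi"
    using False by (metis exp_less_cancel_iff exp_ln zero_less_norm_iff)+
  moreover have "\<zeta> \<notin> \<real>\<^sub>\<le>\<^sub>0 \<longleftrightarrow> \<bar>Im (Ln \<zeta>)\<bar> < pi"
    using False mpi_less_Im_Ln[of \<zeta>] Im_Ln_le_pi[of \<zeta>] Im_Ln_eq_pi[of \<zeta>]
    by (auto simp: complex_nonpos_Reals_iff complex_eq_iff abs_less_iff)
  ultimately show ?thesis
    using False by (auto simp: exp_square_def abs_less_iff)
qed (simp add: exp_square_def)

lemma open_exp_square: "open exp_square"
proof -
  have *: "exp_square = - \<real>\<^sub>\<le>\<^sub>0 \<inter> {\<zeta>. exp (-pi) < cmod \<zeta>} \<inter> {\<zeta>. cmod \<zeta> < exp pi}"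
    by (auto simp: exp_square_def)
  show ?thesis
    unfolding * by (intro open_Int open_Collect_less continuous_intros open_Compl closed_nonpos_Reals_complex)
qed

lemma
  assumes "\<zeta> \<in> exp_square" and c: "c = \<i> \<or> c = -\<i>"
  shows powr_in_exp_square: "\<zeta> powr c \<in> exp_square"
    and powr_powr_exp_square: "(\<zeta> powr c) powr (-c) = \<zeta>"
proof -
  have \<zeta>: "\<zeta> \<noteq> 0" "\<bar>Re (Ln \<zeta>)\<bar> < pi" "\<bar>Im (Ln \<zeta>)\<bar> < pi"
    using assms(1) unfolding exp_square_iff by blast+
  then have "Ln (exp (c * Ln \<zeta>)) = c * Ln \<zeta>"
    using c by (intro Ln_exp) auto
  then have L: "Ln (\<zeta> powr c) = c * Ln \<zeta>"
    using \<zeta>(1) by (simp add: powr_def)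
  have n: "\<zeta> powr c \<noteq> 0"
    using \<zeta>(1) by simp
  show "\<zeta> powr c \<in> exp_square"
    unfolding exp_square_iff L using n c \<zeta> by auto
  have "(-c) * (c * Ln \<zeta>) = Ln \<zeta>"
    using c by auto
  then show "(\<zeta> powr c) powr (-c) = \<zeta>"
    using n L \<zeta>(1) unfolding powr_def[of "\<zeta> powr c"] by simp
qed

section \<open>Straightening the worm\<close>

text \<open>
  The branch of \<open>z\<^sup>i\<close> whose cut passes through \<open>- a\<close>, so that it is holomorphic near \<open>a\<close>.
\<close>

definition ipow_branch :: "complex \<Rightarrow> complex \<Rightarrow> complex" where
  "ipow_branch a z = a powr \<i> * (z / a) powr \<i>"

definition worm_map :: "complex \<Rightarrow> complex \<times> complex \<Rightarrow> complex \<times> complex" where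
  "worm_map a p =
     (\<i> - \<i> * ipow_branch a (fst p),
      \<i> - 2 * \<i> * ipow_branch a (fst p) + 2 * \<i> * (ipow_branch a (fst p) * ipow_branch a (fst p)) / snd p)"

text \<open>
  In terms of \<open>u\<close>, the map is \<open>Z = \<i> - \<i> u\<close> and \<open>W = \<i> - 2 \<i> u + 2 \<i> u\<^sup>2 / w\<close>; hence \<open>u = 1 + \<i> Z\<close> and
  \<open>2 u\<^sup>2 / w = 1 + 2 \<i> Z - \<i> W\<close>.
\<close>

definition worm_map_inverse :: "complex \<Rightarrow> complex \<times> complex \<Rightarrow> complex \<times> complex" where
  "worm_map_inverse a q =
     (a * ((1 + \<i> * fst q) / a powr \<i>) powr (-\<i>),
      2 * ((1 + \<i> * fst q) * (1 + \<i> * fst q)) / (1 + 2 * \<i> * fst q - \<i> * snd q))"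

definition worm_chart :: "complex \<Rightarrow> (complex \<times> complex) set" where
  "worm_chart a = {p. fst p / a \<in> exp_square \<and> snd p \<noteq> 0}"

lemma exp_square_nonzero: "\<zeta> \<in> exp_square \<Longrightarrow> \<zeta> \<noteq> 0"
  by (simp add: exp_square_iff)

lemma exp_square_not_nonpos: "\<zeta> \<in> exp_square \<Longrightarrow> \<zeta> \<notin> \<real>\<^sub>\<le>\<^sub>0"
  by (simp add: exp_square_def)

lemma open_worm_chart: "a \<noteq> 0 \<Longrightarrow> open (worm_chart a)"
  unfolding worm_chart_def
  by (intro open_Collect_conj open_Collect_neq continuous_intros
      open_vimage[OF open_exp_square, of "\<lambda>p. fst p / a", unfolded vimage_def]) auto

lemma worm_chart_contains: "z \<noteq> 0 \<Longrightarrow> w \<noteq> 0 \<Longrightarrow> (z, w) \<in> worm_chart z"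
  by (simp add: worm_chart_def exp_square_iff pi_gt_zero)

lemma biholomorphic_worm_map:
  assumes a: "a \<noteq> 0"
  shows "biholomorphic_onto_image (worm_map a) (worm_chart a)"
proof -
  define b where "b = a powr \<i>"
  define V :: "(complex \<times> complex) set" where
    "V = {q. (1 + \<i> * fst q) / b \<in> exp_square \<and> 1 + 2 * \<i> * fst q - \<i> * snd q \<noteq> 0}"
  have b: "b \<noteq> 0"
    using a by (simp add: b_def)
  show ?thesis
  proof (rule biholomorphic_onto_imageI[of _ V _ "worm_map_inverse a"])
    show "open (worm_chart a)"
      using a by (rule open_worm_chart)
    show "open V"
      unfolding V_def using b
      by (intro open_Collect_conj open_Collect_neq continuous_intros
          open_vimage[OF open_exp_square, of "\<lambda>q. (1 + \<i> * fst q) / b", unfolded vimage_def]) auto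
    show "holomorphic_map_on (worm_map a) (worm_chart a)"
      unfolding worm_map_def[abs_def] ipow_branch_def worm_chart_def
      by (intro holomorphic_map_on_Pair holomorphic_fun_intros) (use a in \<open>auto simp: exp_square_not_nonpos\<close>)
    show "holomorphic_map_on (worm_map_inverse a) V"
      unfolding worm_map_inverse_def[abs_def] V_def b_def[symmetric]
      by (intro holomorphic_map_on_Pair holomorphic_fun_intros) (use b in \<open>auto simp: exp_square_not_nonpos\<close>)
  next
    fix p assume p: "p \<in> worm_chart a"
    define u where "u = ipow_branch a (fst p)"
    have w: "snd p \<noteq> 0" and \<zeta>: "fst p / a \<in> exp_square"
      using p by (auto simp: worm_chart_def)
    have ub: "u / b = (fst p / a) powr \<i>"
      using b by (simp add: u_def ipow_branch_def b_def)
    have u0: "u \<noteq> 0"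
      using ub exp_square_nonzero[OF \<zeta>] by auto
    have q: "worm_map a p = (\<i> - \<i> * u, \<i> - 2 * \<i> * u + 2 * \<i> * (u * u) / snd p)"
      by (simp add: worm_map_def u_def)
    have 1: "1 + \<i> * fst (worm_map a p) = u"
      by (simp add: q algebra_simps)
    have 2: "1 + 2 * \<i> * fst (worm_map a p) - \<i> * snd (worm_map a p) = 2 * (u * u) / snd p"
      using w by (simp add: q field_simps)
    show "worm_map a p \<in> V"
      using powr_in_exp_square[OF \<zeta>, of \<i>] u0 w unfolding V_def mem_Collect_eq 1 2 ub by simp
    show "worm_map_inverse a (worm_map a p) = p"
      using powr_powr_exp_square[OF \<zeta>, of \<i>] u0 w a
      unfolding worm_map_inverse_def 1 2 b_def[symmetric] ub by (simp add: prod_eq_iff)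
  next
    fix q assume q: "q \<in> V"
    define u where "u = 1 + \<i> * fst q"
    define d where "d = 1 + 2 * \<i> * fst q - \<i> * snd q"
    have \<zeta>: "u / b \<in> exp_square" and d: "d \<noteq> 0"
      using q by (auto simp: V_def u_def d_def)
    have u0: "u \<noteq> 0"
      using exp_square_nonzero[OF \<zeta>] by auto
    have p: "worm_map_inverse a q = (a * (u / b) powr (-\<i>), 2 * (u * u) / d)"
      by (simp add: worm_map_inverse_def u_def d_def b_def)
    show "worm_map_inverse a q \<in> worm_chart a"
      using powr_in_exp_square[OF \<zeta>, of "-\<i>"] u0 d a by (simp add: worm_chart_def p)
    have "ipow_branch a (fst (worm_map_inverse a q)) = u"
      using powr_powr_exp_square[OF \<zeta>, of "-\<i>"] a b by (simp add: ipow_branch_def p b_def)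
    then have "worm_map a (worm_map_inverse a q) = (\<i> - \<i> * u, \<i> - 2 * \<i> * u + \<i> * d)"
      using u0 d by (simp add: worm_map_def p)
    also have "\<dots> = q"
      by (simp add: u_def d_def prod_eq_iff algebra_simps)
    finally show "worm_map a (worm_map_inverse a q) = q" .
  qed
qed

text \<open>
  Any logarithm \<open>s\<close> of \<open>z\<close> satisfies \<open>s + cnj s = ln \<bar>z\<bar>\<^sup>2\<close>, and \<open>\<i> s + \<i> (cnj s)\<close> is the exponent of
  \<open>exp (\<i> s) / cnj (exp (\<i> s))\<close>.
\<close>

lemma worm_centre_eq_ratio:
  assumes "exp s = z"
  shows "exp (\<i> * s) = exp (\<i> * of_real (ln ((cmod z)\<^sup>2))) * cnj (exp (\<i> * s))"
proof -
  have "(cmod z)\<^sup>2 = exp (2 * Re s)"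
    using assms by (auto simp: power2_eq_square exp_add[symmetric])
  then have "\<i> * of_real (ln ((cmod z)\<^sup>2)) + cnj (\<i> * s) = \<i> * s"
    by (simp add: complex_eq_iff)
  then show ?thesis
    by (metis exp_add exp_cnj)
qed

lemma ipow_branch_eq_exp:
  assumes "a \<noteq> 0" "z \<noteq> 0"
  obtains s where "exp s = z" "ipow_branch a z = exp (\<i> * s)"
proof
  show "exp (Ln a + Ln (z / a)) = z"
    using assms by (simp add: exp_add)
  show "ipow_branch a z = exp (\<i> * (Ln a + Ln (z / a)))"
    using assms by (simp add: ipow_branch_def powr_def exp_add distrib_left)
qed

text \<open>
  With \<open>E\<close> the centre and \<open>u = E * cnj u\<close>, the equation \<open>\<bar>w - E\<bar>\<^sup>2 = 1\<close> says \<open>2 Re (E / w) = 1\<close>, and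
  \<open>u\<^sup>2 / w = \<bar>u\<bar>\<^sup>2 E / w\<close>.  The constants in the map are such that \<open>\<bar>Z\<bar>\<^sup>2\<close> and \<open>Im W\<close> both acquire the
  same extra terms \<open>1 - 2 Re u\<close>.
\<close>

lemma worm_map_in_heisenberg:
  assumes a: "a \<noteq> 0" and z: "z \<noteq> 0" and w: "w \<noteq> 0"
    and M: "(cmod (w - exp (\<i> * of_real (ln ((cmod z)\<^sup>2)))))\<^sup>2 = 1"
  shows "worm_map a (z, w) \<in> heisenberg"
proof -
  define u where "u = ipow_branch a z"
  define E where "E = exp (\<i> * of_real (ln ((cmod z)\<^sup>2)))"
  have uE: "u = E * cnj u"
    using ipow_branch_eq_exp[OF a z] worm_centre_eq_ratio unfolding u_def E_def by metis
  have E1: "(cmod E)\<^sup>2 = 1"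
    by (simp add: E_def)
  have "(cmod (w - E))\<^sup>2 = (cmod w)\<^sup>2 - 2 * Re (E * cnj w) + (cmod E)\<^sup>2"
    unfolding cmod_power2 by (simp add: power2_eq_square algebra_simps)
  then have *: "2 * Re (E * cnj w) = (cmod w)\<^sup>2"
    using M E1 by (simp add: E_def)
  have "u * u / w = of_real ((cmod u)\<^sup>2) * (E / w)"
    using uE complex_norm_square[of u] by (metis mult.assoc mult.commute times_divide_eq_right)
  then have "2 * Re (u * u / w) = (cmod u)\<^sup>2 * (2 * Re (E / w))"
    by (simp only: Re_complex_of_real Im_complex_of_real times_complex.sel) simp
  also have "2 * Re (E / w) = 1"
    using * w by (simp add: complex_div_cnj[of E w] Re_divide_of_real)
  finally have "2 * Re (u * u / w) = (cmod u)\<^sup>2"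
    by simp
  moreover have "worm_map a (z, w) = (\<i> - \<i> * u, \<i> - 2 * \<i> * u + \<i> * (2 * (u * u / w)))"
    by (simp add: worm_map_def u_def)
  moreover have "(cmod (\<i> - \<i> * u))\<^sup>2 = 1 - 2 * Re u + (cmod u)\<^sup>2"
    unfolding cmod_power2 by (simp add: power2_eq_square algebra_simps)
  ultimately show ?thesis
    by (simp add: heisenberg_def del: times_divide_eq_right)
qed

lemma worm_map_image_subset_heisenberg:
  assumes "a \<noteq> 0"
  shows "worm_map a ` (worm_boundary \<inter> worm_chart a) \<subseteq> heisenberg"
  using worm_map_in_heisenberg[OF assms]
  by (auto simp: worm_boundary_eq worm_chart_def)

lemma locally_spherical_at_worm_boundary:
  assumes "M \<subseteq> worm_boundary" "p \<in> worm_boundary" "snd p \<noteq> 0"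
  shows "locally_spherical_at M p"
proof -
  have a: "fst p \<noteq> 0"
    using assms(2) by (auto simp: worm_boundary_eq)
  have "worm_map (fst p) ` (M \<inter> worm_chart (fst p)) \<subseteq> heisenberg"
    using worm_map_image_subset_heisenberg[OF a] assms(1) by blast
  then show ?thesis
    unfolding locally_spherical_at_def
    using open_worm_chart[OF a] worm_chart_contains[OF a assms(3)] biholomorphic_worm_map[OF a]
    by (metis prod.collapse)
qed

section \<open>Smoothness of the boundary\<close>

lemma frechet_derivative_eq:
  "(f has_derivative f') (at q) \<Longrightarrow> frechet_derivative f (at q) = f'"
  by (metis frechet_derivative_at)

lemma Ck_on_cong:
  assumes "open U" "\<And>q. q \<in> U \<Longrightarrow> f q = g q" "Ck_on k f U"
  shows "Ck_on k g U"
  using assms(2,3)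
proof (induction k arbitrary: f g)
  case 0
  then show ?case
    by (simp cong: continuous_on_cong)
next
  case (Suc k)
  have g': "(g has_derivative frechet_derivative f (at q)) (at q)" if "q \<in> U" for q
    using Suc.prems assms(1) that
    by (auto simp: frechet_derivative_works intro: has_derivative_transform_within_open[of f _ q UNIV U])
  have "Ck_on k (\<lambda>q. frechet_derivative g (at q) v) U" for v
  proof (rule Suc.IH)
    show "frechet_derivative f (at q) v = frechet_derivative g (at q) v" if "q \<in> U" for q
      using frechet_derivative_eq[OF g'[OF that]] by simp
    show "Ck_on k (\<lambda>q. frechet_derivative f (at q) v) U"
      using Suc.prems(2) unfolding Ck_on.simps by blast
  qed
  moreover have "g differentiable (at q)" if "q \<in> U" for q
    using g'[OF that] by (rule differentiableI)
  ultimately show ?case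
    unfolding Ck_on.simps by blast
qed

text \<open>
  Smoothness of a whole family at once: the directional derivatives lie again in the family, so the
  order of differentiability can be raised indefinitely.
\<close>

lemma Ck_on_if_closed_under_derivatives:
  assumes U: "open U"
    and F: "\<And>f. F f \<Longrightarrow> \<exists>f'. (\<forall>q\<in>U. (f has_derivative f' q) (at q)) \<and> (\<forall>v. F (\<lambda>q. f' q v))"
    and "F f"
  shows "Ck_on k f U"
  using \<open>F f\<close>
proof (induction k arbitrary: f)
  case 0
  then show ?case
    using F by (auto intro!: continuous_at_imp_continuous_on dest: has_derivative_continuous)
next
  case (Suc k)
  obtain f' where f': "\<And>q. q \<in> U \<Longrightarrow> (f has_derivative f' q) (at q)" "\<And>v. F (\<lambda>q. f' q v)"
    using F[OF Suc.prems] by blast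
  have "Ck_on k (\<lambda>q. frechet_derivative f (at q) v) U" for v
    by (rule Ck_on_cong[OF U _ Suc.IH[OF f'(2)[of v]]]) (simp add: frechet_derivative_eq[OF f'(1)])
  then show ?case
    using f'(1) unfolding Ck_on.simps differentiable_def by blast
qed

text \<open>
  The algebra generated by the coordinates, the coordinates of the centre of the worm and the inverse
  of \<open>\<bar>z\<bar>\<^sup>2\<close>.  The last generator is there because it occurs in the derivatives of the centre; its own
  derivatives bring in nothing new.
\<close>

inductive worm_algebra :: "(complex \<times> complex \<Rightarrow> real) \<Rightarrow> bool" where
  const: "worm_algebra (\<lambda>q. c)"
| Re_fst: "worm_algebra (\<lambda>q. Re (fst q))"
| Im_fst: "worm_algebra (\<lambda>q. Im (fst q))"
| Re_snd: "worm_algebra (\<lambda>q. Re (snd q))"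
| Im_snd: "worm_algebra (\<lambda>q. Im (snd q))"
| cos_ln: "worm_algebra (\<lambda>q. cos (ln ((cmod (fst q))\<^sup>2)))"
| sin_ln: "worm_algebra (\<lambda>q. sin (ln ((cmod (fst q))\<^sup>2)))"
| inverse_norm: "worm_algebra (\<lambda>q. inverse ((cmod (fst q))\<^sup>2))"
| add: "worm_algebra f \<Longrightarrow> worm_algebra g \<Longrightarrow> worm_algebra (\<lambda>q. f q + g q)"
| mult: "worm_algebra f \<Longrightarrow> worm_algebra g \<Longrightarrow> worm_algebra (\<lambda>q. f q * g q)"

lemma has_derivative_norm_fst_squared:
  "((\<lambda>q. (cmod (fst q))\<^sup>2) has_derivative
     (\<lambda>v. 2 * (Re (fst q) * Re (fst v) + Im (fst q) * Im (fst v)))) (at (q :: complex \<times> complex))"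
  unfolding cmod_power2 by (auto intro!: derivative_eq_intros simp: algebra_simps)

lemma has_derivative_inverse_norm_fst_squared:
  assumes "fst (q :: complex \<times> complex) \<noteq> 0"
  shows "((\<lambda>q. inverse ((cmod (fst q))\<^sup>2)) has_derivative
    (\<lambda>v. (- 1) * (inverse ((cmod (fst q))\<^sup>2) *
      (2 * (Re (fst q) * Re (fst v) + Im (fst q) * Im (fst v))) * inverse ((cmod (fst q))\<^sup>2)))) (at q)"
proof -
  have "(cmod (fst q))\<^sup>2 \<noteq> 0"
    using assms by simp
  from Deriv.has_derivative_inverse[OF this has_derivative_norm_fst_squared]
  show ?thesis
    unfolding mult_minus1 .
qed

lemma has_derivative_ln_norm_fst_squared:
  assumes "fst (q :: complex \<times> complex) \<noteq> 0"
  shows "((\<lambda>q. ln ((cmod (fst q))\<^sup>2)) has_derivative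
    (\<lambda>v. 2 * (Re (fst q) * Re (fst v) + Im (fst q) * Im (fst v)) * inverse ((cmod (fst q))\<^sup>2))) (at q)"
proof -
  have "(cmod (fst q))\<^sup>2 > 0"
    using assms by simp
  from DERIV_compose_FDERIV[OF DERIV_ln[OF this] has_derivative_norm_fst_squared]
  show ?thesis .
qed

lemma worm_algebra_closed_under_derivatives:
  assumes "worm_algebra f"
  shows "\<exists>f'. (\<forall>q\<in>{q. fst q \<noteq> 0}. (f has_derivative f' q) (at q)) \<and> (\<forall>v. worm_algebra (\<lambda>q. f' q v))"
  using assms
proof induction
  let ?N = "\<lambda>q::complex \<times> complex. inverse ((cmod (fst q))\<^sup>2)"
  let ?L = "\<lambda>q::complex \<times> complex. ln ((cmod (fst q))\<^sup>2)"
  let ?D = "\<lambda>q v::complex \<times> complex. 2 * (Re (fst q) * Re (fst v) + Im (fst q) * Im (fst v))"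
  note N = has_derivative_inverse_norm_fst_squared
  note L = has_derivative_ln_norm_fst_squared
  {
    case (const c)
    show ?case
      by (intro exI[of _ "\<lambda>q v. 0"]) (auto intro!: worm_algebra.intros)
  next
    case Re_fst
    show ?case
      by (intro exI[of _ "\<lambda>q v. Re (fst v)"]) (auto intro!: worm_algebra.intros derivative_eq_intros)
  next
    case Im_fst
    show ?case
      by (intro exI[of _ "\<lambda>q v. Im (fst v)"]) (auto intro!: worm_algebra.intros derivative_eq_intros)
  next
    case Re_snd
    show ?case
      by (intro exI[of _ "\<lambda>q v. Re (snd v)"]) (auto intro!: worm_algebra.intros derivative_eq_intros)
  next
    case Im_snd
    show ?case
      by (intro exI[of _ "\<lambda>q v. Im (snd v)"]) (auto intro!: worm_algebra.intros derivative_eq_intros)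
  next
    case cos_ln
    show ?case
      by (intro exI[of _ "\<lambda>q v. ?D q v * ?N q * ((- 1) * sin (?L q))"] conjI ballI allI worm_algebra.intros)
        (unfold mult_minus1 mem_Collect_eq, rule DERIV_compose_FDERIV[OF DERIV_cos L])
  next
    case sin_ln
    show ?case
      by (intro exI[of _ "\<lambda>q v. ?D q v * ?N q * cos (?L q)"] conjI ballI allI worm_algebra.intros)
        (unfold mem_Collect_eq, rule DERIV_compose_FDERIV[OF DERIV_sin L])
  next
    case inverse_norm
    show ?case
      by (intro exI[of _ "\<lambda>q v. (- 1) * (?N q * ?D q v * ?N q)"] conjI ballI allI worm_algebra.intros)
        (unfold mem_Collect_eq, rule N)
  next
    case (add f g)
    then obtain f' g' where
      "\<forall>q\<in>{q. fst q \<noteq> 0}. (f has_derivative f' q) (at q)" "\<forall>v. worm_algebra (\<lambda>q. f' q v)"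
      "\<forall>q\<in>{q. fst q \<noteq> 0}. (g has_derivative g' q) (at q)" "\<forall>v. worm_algebra (\<lambda>q. g' q v)"
      by blast
    then show ?case
      by (intro exI[of _ "\<lambda>q v. f' q v + g' q v"] conjI ballI allI worm_algebra.intros derivative_intros)
        auto
  next
    case (mult f g)
    then obtain f' g' where
      "\<forall>q\<in>{q. fst q \<noteq> 0}. (f has_derivative f' q) (at q)" "\<forall>v. worm_algebra (\<lambda>q. f' q v)"
      "\<forall>q\<in>{q. fst q \<noteq> 0}. (g has_derivative g' q) (at q)" "\<forall>v. worm_algebra (\<lambda>q. g' q v)"
      by blast
    with mult.hyps show ?case
      by (intro exI[of _ "\<lambda>q v. f q * g' q v + f' q v * g q"] conjI ballI allI worm_algebra.intros
          has_derivative_mult) auto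
  }
qed

definition worm_defining_function :: "complex \<times> complex \<Rightarrow> real" where
  "worm_defining_function q = (cmod (snd q - exp (\<i> * of_real (ln ((cmod (fst q))\<^sup>2)))))\<^sup>2 - 1"

lemma worm_algebra_defining_function: "worm_algebra worm_defining_function"
proof -
  let ?L = "\<lambda>q::complex \<times> complex. ln ((cmod (fst q))\<^sup>2)"
  have *: "worm_defining_function =
    (\<lambda>q. (Re (snd q) + (- 1) * cos (?L q)) * (Re (snd q) + (- 1) * cos (?L q)) +
         (Im (snd q) + (- 1) * sin (?L q)) * (Im (snd q) + (- 1) * sin (?L q)) + (- 1))"
    unfolding worm_defining_function_def[abs_def] cmod_power2[of "snd _ - _"]
    by (simp add: Re_exp Im_exp power2_eq_square)
  show ?thesis
    unfolding * by (intro worm_algebra.intros)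
qed

lemma Ck_on_worm_defining_function:
  assumes "open U" "U \<subseteq> {q. fst q \<noteq> 0}"
  shows "Ck_on k worm_defining_function U"
proof (rule Ck_on_if_closed_under_derivatives[where F = worm_algebra, OF assms(1) _ worm_algebra_defining_function])
  fix f assume "worm_algebra f"
  from worm_algebra_closed_under_derivatives[OF this] obtain f' where
    "\<forall>q\<in>{q. fst q \<noteq> 0}. (f has_derivative f' q) (at q)" "\<forall>v. worm_algebra (\<lambda>q. f' q v)"
    by blast
  then show "\<exists>f'. (\<forall>q\<in>U. (f has_derivative f' q) (at q)) \<and> (\<forall>v. worm_algebra (\<lambda>q. f' q v))"
    using assms(2) by blast
qed

lemma open_fst_nonzero: "open {q :: complex \<times> complex. fst q \<noteq> 0}"
  by (intro open_Collect_neq continuous_intros)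

lemma frechet_derivative_along_line:
  assumes "f differentiable (at p)"
  shows "((\<lambda>t. f (p + t *\<^sub>R v)) has_real_derivative frechet_derivative f (at p) v) (at 0)"
proof -
  have f: "(f has_derivative frechet_derivative f (at p)) (at p)"
    using assms by (simp add: frechet_derivative_works)
  have "((\<lambda>t. p + t *\<^sub>R v) has_derivative (\<lambda>t. t *\<^sub>R v)) (at 0)"
    by (auto intro!: derivative_eq_intros)
  then have "((\<lambda>t. f (p + t *\<^sub>R v)) has_derivative (\<lambda>t. frechet_derivative f (at p) (t *\<^sub>R v))) (at 0)"
    using has_derivative_compose[of "\<lambda>t. p + t *\<^sub>R v" _ 0 UNIV f] f by simp
  then show ?thesis
    using linear_scale[OF has_derivative_linear[OF f]]
    unfolding has_field_derivative_def by (auto elim!: back_subst[of "\<lambda>D. (_ has_derivative D) _"])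
qed

text \<open>
  The differential of the defining function is nonzero because the function grows strictly along the
  ray that leaves the centre of the circle through the given point.
\<close>

lemma real_hypersurface_worm_boundary: "real_hypersurface (worm_boundary - worm_annulus)"
  unfolding real_hypersurface_def
proof
  let ?\<rho> = worm_defining_function
  let ?U = "{q :: complex \<times> complex. fst q \<noteq> 0 \<and> snd q \<noteq> 0}"
  fix p assume p: "p \<in> worm_boundary - worm_annulus"
  have oU: "open ?U"
    by (intro open_Collect_conj open_Collect_neq continuous_intros)
  have Ck: "Ck_on k ?\<rho> ?U" for k
    using oU by (rule Ck_on_worm_defining_function) blast
  have M: "(worm_boundary - worm_annulus) \<inter> ?U = {q \<in> ?U. ?\<rho> q = 0}"
    by (auto simp: worm_boundary_minus_annulus_eq worm_defining_function_def)
  have "\<exists>v. frechet_derivative ?\<rho> (at q) v \<noteq> 0" if q: "q \<in> (worm_boundary - worm_annulus) \<inter> ?U" for q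
  proof -
    define e where "e = snd q - exp (\<i> * of_real (ln ((cmod (fst q))\<^sup>2)))"
    have e: "(cmod e)\<^sup>2 = 1"
      using q unfolding M by (simp add: worm_defining_function_def e_def)
    have "?\<rho> (q + t *\<^sub>R (0, e)) = (1 + t)\<^sup>2 - 1" for t
    proof -
      have "?\<rho> (q + t *\<^sub>R (0, e)) = (cmod (of_real (1 + t) * e))\<^sup>2 - 1"
        by (simp add: worm_defining_function_def e_def scaleR_conv_of_real algebra_simps)
      then show ?thesis
        using e by (simp only: norm_mult power_mult_distrib norm_of_real power2_abs)
    qed
    moreover have "?\<rho> differentiable (at q)"
      using Ck[of "Suc 0"] q unfolding Ck_on.simps by blast
    ultimately have "((\<lambda>t. (1 + t)\<^sup>2 - 1) has_real_derivative frechet_derivative ?\<rho> (at q) (0, e)) (at 0)"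
      using frechet_derivative_along_line[of ?\<rho> q "(0, e)"] by simp
    moreover have "((\<lambda>t::real. (1 + t)\<^sup>2 - 1) has_real_derivative 2) (at 0)"
      by (auto intro!: derivative_eq_intros)
    ultimately have "frechet_derivative ?\<rho> (at q) (0, e) = 2"
      by (rule DERIV_unique)
    then show ?thesis
      by (metis zero_neq_numeral)
  qed
  moreover have "p \<in> ?U"
    using p by (auto simp: worm_boundary_minus_annulus_eq)
  ultimately show "\<exists>U \<rho>. open U \<and> p \<in> U \<and> (\<forall>k. Ck_on k \<rho> U) \<and>
      (worm_boundary - worm_annulus) \<inter> U = {q \<in> U. \<rho> q = 0} \<and>
      (\<forall>q \<in> (worm_boundary - worm_annulus) \<inter> U. \<exists>v. frechet_derivative \<rho> (at q) v \<noteq> 0)"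
    using oU Ck M by blast
qed

section \<open>Degeneracy along the annulus\<close>

lemma frechet_derivative_zero_along_line:
  assumes "f differentiable (at p)" "\<epsilon> > 0" "\<And>t. \<bar>t\<bar> < \<epsilon> \<Longrightarrow> f (p + t *\<^sub>R v) = 0"
  shows "frechet_derivative f (at p) v = (0::real)"
proof -
  have "((\<lambda>t::real. 0) has_real_derivative frechet_derivative f (at p) v) (at 0)"
    using frechet_derivative_along_line[OF assms(1), of v]
    by (rule has_field_derivative_transform_within[OF _ assms(2)]) (use assms(3) in auto)
  then show ?thesis
    using DERIV_unique DERIV_const by metis
qed

lemma frechet_derivative_zero_on_axis:
  assumes "open U" "p \<in> U" "snd p = 0"
    and "\<And>q. q \<in> U \<Longrightarrow> snd q = 0 \<Longrightarrow> f q = (0::real)"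
    and "f differentiable (at p)"
  shows "frechet_derivative f (at p) (h :: complex, 0 :: complex) = 0"
proof -
  have "open ((\<lambda>t. p + t *\<^sub>R (h, 0)) -` U)"
    by (intro open_vimage assms continuous_intros)
  moreover have "0 \<in> (\<lambda>t. p + t *\<^sub>R (h, 0)) -` U"
    using assms(2) by (simp add: zero_prod_def[symmetric])
  ultimately obtain \<epsilon> where "\<epsilon> > 0" "ball 0 \<epsilon> \<subseteq> (\<lambda>t. p + t *\<^sub>R (h, 0)) -` U"
    by (meson openE)
  then have "p + t *\<^sub>R (h, 0) \<in> U" if "\<bar>t\<bar> < \<epsilon>" for t
    using that by (auto simp: subset_iff)
  then show ?thesis
    using frechet_derivative_zero_along_line[OF assms(5) \<open>\<epsilon> > 0\<close>] assms(3,4) by simp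
qed

text \<open>
  A defining function is nonnegative off the domain and, by continuity, nonpositive on the closure.
\<close>

lemma defining_function_zero_on_frontier:
  assumes "open U" "continuous_on U \<rho>" "D \<inter> U = {q \<in> U. \<rho> q < (0::real)}"
    and "open D" "q \<in> U" "q \<in> frontier D"
  shows "\<rho> q = 0"
proof -
  have "q \<notin> D"
    using assms(4,6) by (simp add: frontier_def interior_open)
  then have "\<rho> q \<ge> 0"
    using assms(3,5) by force
  moreover have "\<not> \<rho> q > 0"
  proof
    assume "\<rho> q > 0"
    have "open (\<rho> -` {0<..} \<inter> U)"
      using assms(1,2) by (simp add: continuous_on_open_vimage)
    moreover have "(\<rho> -` {0<..} \<inter> U) \<inter> D = {}"
      using assms(3) by force
    ultimately have "(\<rho> -` {0<..} \<inter> U) \<inter> closure D = {}"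
      by (simp add: open_Int_closure_eq_empty)
    then show False
      using \<open>\<rho> q > 0\<close> assms(5,6) by (auto simp: frontier_def)
  qed
  ultimately show ?thesis
    by simp
qed

lemma open_worm: "open worm"
proof -
  let ?U = "{q :: complex \<times> complex. fst q \<noteq> 0}"
  have "continuous_on ?U worm_defining_function"
    using Ck_on_worm_defining_function[OF open_fst_nonzero order_refl, of 0] by simp
  then have "open (worm_defining_function -` {..<0} \<inter> ?U)"
    using open_fst_nonzero by (simp add: continuous_on_open_vimage)
  also have "worm_defining_function -` {..<0} \<inter> ?U = worm"
    by (auto simp: worm_def worm_defining_function_def)
  finally show ?thesis .
qed

text \<open>
  The defining function \<open>\<rho>\<close> vanishes on the curve \<open>w = 0\<close>, hence so does its differential in
  the directions \<open>(h, 0)\<close>; differentiating once more along the curve kills every term of the Levi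
  form at \<open>(1, 0)\<close>.
\<close>

lemma worm_annulus_not_strongly_pseudoconvex:
  assumes p: "p \<in> worm_boundary" "snd p = 0"
  shows "\<not> strongly_pseudoconvex_at worm p"
proof
  assume "strongly_pseudoconvex_at worm p"
  then obtain U \<rho> where U: "open U" "p \<in> U" and C2: "Ck_on 2 \<rho> U"
    and D: "worm \<inter> U = {q \<in> U. \<rho> q < 0}"
    and levi: "\<And>v. v \<noteq> 0 \<Longrightarrow> complex_tangent \<rho> p v \<Longrightarrow> levi_form \<rho> p v > 0"
    unfolding strongly_pseudoconvex_at_def by blast
  define V where "V = U \<inter> {q. fst q \<noteq> 0}"
  have V: "open V" "p \<in> V"
    using U open_fst_nonzero p(1) by (auto simp: V_def worm_boundary_eq)
  have d1: "\<rho> differentiable (at q)" if "q \<in> U" for q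
    using C2 that by (simp add: numeral_2_eq_2)
  have d2: "(\<lambda>q. frechet_derivative \<rho> (at q) v) differentiable (at q)" if "q \<in> U" for q v
    using C2 that by (cases v) (simp add: numeral_2_eq_2)
  have "continuous_on U \<rho>"
    using d1 by (meson continuous_at_imp_continuous_on differentiable_imp_continuous_within)
  then have \<rho>0: "\<rho> q = 0" if "q \<in> V" "snd q = 0" for q
  proof (rule defining_function_zero_on_frontier[OF U(1) _ D open_worm])
    show "q \<in> U"
      using that by (simp add: V_def)
    have "q \<in> worm_boundary"
      using that unfolding worm_boundary_eq by (cases q) (simp add: V_def)
    then show "q \<in> frontier worm"
      by (simp add: worm_boundary_def)
  qed
  have \<rho>1: "frechet_derivative \<rho> (at q) (h, 0) = 0" if "q \<in> V" "snd q = 0" for q h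
    by (rule frechet_derivative_zero_on_axis[OF V(1) that \<rho>0 d1]) (use that in \<open>auto simp: V_def\<close>)
  have \<rho>2: "second_derivative \<rho> p (h, 0) (k, 0) = 0" for h k
    unfolding second_derivative_def
    by (rule frechet_derivative_zero_on_axis[OF V p(2) \<rho>1 d2[OF U(2)]])
  have "complex_tangent \<rho> p (1, 0)"
    using \<rho>1[OF V(2) p(2)] by (simp add: complex_tangent_def cscale_def)
  moreover have "levi_form \<rho> p (1, 0) = 0"
    by (simp add: levi_form_def cscale_def \<rho>2)
  ultimately show False
    using levi[of "(1, 0)"] by (simp add: zero_prod_def)
qed

section \<open>Local sphericity of the worm boundary\<close>

lemma worm_map_one:
  "worm_map 1 = (\<lambda>(z, w). (\<i> - \<i> * z powr \<i>, \<i> - 2 * \<i> * z powr \<i> + 2 * \<i> * z powr (2 * \<i>) / w))"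
proof -
  have "z powr (2 * \<i>) = z powr \<i> * z powr \<i>" for z :: complex
    using powr_add[of z \<i> \<i>] by simp
  then show ?thesis
    by (auto simp: worm_map_def ipow_branch_def fun_eq_iff)
qed

theorem corollary2:
  shows "locally_spherical (worm_boundary - worm_annulus) \<and>
    (\<forall>p\<in>worm_boundary. strongly_pseudoconvex_at worm p \<longrightarrow> locally_spherical_at worm_boundary p) \<and>
    (let \<Phi> = (\<lambda>(z::complex, w::complex).
           (\<i> - \<i> * z powr \<i>, \<i> - 2 * \<i> * z powr \<i> + 2 * \<i> * z powr (2 * \<i>) / w))
     in \<Phi> (1, 2) = (0, 0) \<and>
        (\<exists>U. (1, 2) \<in> U \<and> biholomorphic_onto_image \<Phi> U \<and>
             \<Phi> ` ((worm_boundary - worm_annulus) \<inter> U) \<subseteq> heisenberg))"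
proof (intro conjI)
  have "locally_spherical_at (worm_boundary - worm_annulus) p" if "p \<in> worm_boundary - worm_annulus" for p
    using that by (intro locally_spherical_at_worm_boundary) (auto simp: worm_annulus_def)
  then show "locally_spherical (worm_boundary - worm_annulus)"
    using real_hypersurface_worm_boundary by (simp add: locally_spherical_def)
  show "\<forall>p\<in>worm_boundary. strongly_pseudoconvex_at worm p \<longrightarrow> locally_spherical_at worm_boundary p"
    using locally_spherical_at_worm_boundary[OF order_refl] worm_annulus_not_strongly_pseudoconvex
    by blast
  have "worm_map 1 (1, 2) = (0, 0)"
    by (simp add: worm_map_def ipow_branch_def)
  moreover have "(1, 2) \<in> worm_chart 1"
    by (rule worm_chart_contains) auto
  moreover have "biholomorphic_onto_image (worm_map 1) (worm_chart 1)"
    by (rule biholomorphic_worm_map) simp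
  moreover have "worm_map 1 ` ((worm_boundary - worm_annulus) \<inter> worm_chart 1) \<subseteq> heisenberg"
    using worm_map_image_subset_heisenberg[of 1] by auto
  ultimately show "let \<Phi> = (\<lambda>(z::complex, w::complex).
           (\<i> - \<i> * z powr \<i>, \<i> - 2 * \<i> * z powr \<i> + 2 * \<i> * z powr (2 * \<i>) / w))
     in \<Phi> (1, 2) = (0, 0) \<and>
        (\<exists>U. (1, 2) \<in> U \<and> biholomorphic_onto_image \<Phi> U \<and>
             \<Phi> ` ((worm_boundary - worm_annulus) \<inter> U) \<subseteq> heisenberg)"
    unfolding worm_map_one[symmetric] Let_def by blast
qed

end
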